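(* Consider the triggered urn model described in the context with update function $F(x)=\rho x$ for some $\rho>0$, and trigger probabilities satisfying $p_n=p+O(n^{-\beta})$ as $n\to\infty$, where $0\le p<1$ and $\beta>p$. Let $C_\infty=\sup_n C_n$. Then for every observed color $c$, i.e. every color $c$ with $1\le c\le C_\infty$, there is a random variable $K(c)\in(0,\infty)$ such that $$\frac{K_{n,c}}{n^{1-p}}\longrightarrow K(c)\quad\text{almost surely as } n\to\infty.$$
   Context: Triggered (FAQ) urn model. The urn is empty at time $0$. Let $B_0=1$ and let $(B_n)_{n\ge1}$ be independent Bernoulli random variables with $\Pr(B_n=1)=p_n\in(0,1)$, independent of everything else in the construction. Let $F:[1,\infty)\to[0,\infty)$ be strictly increasing with $F(1)>0$. Colors are labelled $1,2,\dots$ in order of first appearance, and a history sequence $\mathcal S=(S_n)_{n\ge1}$ records one color per time step. For a color $c$, $K_{n,c}$ denotes the number of times $c$ has been registered in $\mathcal S$ up to and including time $n$; at time $n$ the urn contains, for each color $c$ already present, a weight $F(K_{n,c})$. At each time $n\ge1$: if $B_{n-1}=1$, a new color is added with weight $F(1)$ and registered in $\mathcal S$; if $B_{n-1}=0$, a color $c$ among those present is drawn with probability $F(K_{n-1,c})/\sum_{c'}F(K_{n-1,c'})$ (sum over colors present at time $n-1$), registered in $\mathcal S$, and its weight becomes $F(K_{n,c})$. $C_n=\sum_{i=0}^{n-1}B_i$ is the number of distinct colors present at time $n$. *)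

theory Defs
  imports "HOL-Probability.Probability" "HOL-Library.Landau_Symbols"
begin

text \<open>A history of the urn is encoded by two sequences: b i is the value of B_i
  (i = 0, 1, ...), and s k is the colour S_k registered at time k (k = 1, 2, ...;
  s 0 is unused).\<close>

definition Kcount :: "(nat \<Rightarrow> nat) \<Rightarrow> nat \<Rightarrow> nat \<Rightarrow> nat" where
  "Kcount s n c = card {k \<in> {1..n}. s k = c}"

text \<open>Conditional probability of the colour registered at time k (k \<ge> 1), given
  B_{k-1} = b (k-1) and the colours registered at times 1..k-1.  The colours present
  at time k-1 are those already registered; a new colour gets the next label.\<close>

definition step_prob ::
  "(real \<Rightarrow> real) \<Rightarrow> (nat \<Rightarrow> bool) \<Rightarrow> (nat \<Rightarrow> nat) \<Rightarrow> nat \<Rightarrow> real" where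
  "step_prob F b s k =
     (let D = s ` {1..k-1} in
      if b (k-1) then (if s k = card D + 1 then 1 else 0)
      else if s k \<in> D then
        F (real (Kcount s (k-1) (s k))) / (\<Sum>c\<in>D. F (real (Kcount s (k-1) c)))
      else 0)"

definition bern_prob :: "(nat \<Rightarrow> real) \<Rightarrow> nat \<Rightarrow> bool \<Rightarrow> real" where
  "bern_prob pn i bi =
     (if i = 0 then (if bi then 1 else 0) else if bi then pn i else 1 - pn i)"

text \<open>The triggered urn with update function F and trigger probabilities pn, realised
  on the probability space M by the processes B and S: all finite-dimensional
  distributions of (B_0..B_n, S_1..S_n) are those of the model (the B_i are independent
  of each other and of all drawings).\<close>

definition triggered_urn ::
  "'a measure \<Rightarrow> (real \<Rightarrow> real) \<Rightarrow> (nat \<Rightarrow> real) \<Rightarrow> (nat \<Rightarrow> 'a \<Rightarrow> bool)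
     \<Rightarrow> (nat \<Rightarrow> 'a \<Rightarrow> nat) \<Rightarrow> bool" where
  "triggered_urn M F pn B S \<longleftrightarrow>
     prob_space M \<and>
     (\<forall>i. B i \<in> measurable M (count_space UNIV)) \<and>
     (\<forall>k. S k \<in> measurable M (count_space UNIV)) \<and>
     (\<forall>n b s. measure M {\<omega> \<in> space M. (\<forall>i\<le>n. B i \<omega> = b i) \<and> (\<forall>k\<in>{1..n}. S k \<omega> = s k)}
        = (\<Prod>i\<le>n. bern_prob pn i (b i)) * (\<Prod>k\<in>{1..n}. step_prob F b s k))"

definition Kn :: "(nat \<Rightarrow> 'a \<Rightarrow> nat) \<Rightarrow> nat \<Rightarrow> nat \<Rightarrow> 'a \<Rightarrow> nat" where
  "Kn S n c \<omega> = Kcount (\<lambda>k. S k \<omega>) n c"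

definition Cn :: "(nat \<Rightarrow> 'a \<Rightarrow> bool) \<Rightarrow> nat \<Rightarrow> 'a \<Rightarrow> nat" where
  "Cn B n \<omega> = card {i. i < n \<and> B i \<omega>}"

end

theory Submission
  imports Defs
begin

text \<open>
  The weights sum to \<open>\<rho> n\<close> at time \<open>n\<close>, so given the past a colour present at time \<open>n\<close> is drawn
  next with probability \<open>x\<^sub>n K\<^sub>n\<close>, where \<open>x\<^sub>n = (1 - p\<^sub>n) / n\<close>. Hence, with
  \<open>a\<^sub>n = (\<Prod>1\<le>j<n. 1 + x\<^sub>j)\<close>, the process \<open>K\<^sub>n / a\<^sub>n\<close> is a martingale from any time on at which the
  colour is present, and \<open>a\<^sub>n \<sim> L n\<^sup>1\<^sup>-\<^sup>p\<close> with \<open>L > 0\<close> because \<open>(p\<^sub>n - p) / n\<close> is absolutely summable.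
  Its squared \<open>L\<^sup>2\<close> increments after time \<open>n\<close> are of order \<open>1 / a\<^sub>n\<close>, so they are summable in \<open>L\<^sup>1\<close> along
  a polynomial subsequence; since \<open>K\<^sub>n\<close> is monotone, almost sure convergence along the subsequence
  gives almost sure convergence, and no martingale convergence theorem is needed.

  The limit is positive because the process \<open>\<Prod>1\<le>j<K\<^sub>n. 1 - 1 / (2 j)\<close>, which is of order
  \<open>1 / sqrt K\<^sub>n\<close>, has expectation proportional to \<open>\<Prod>1\<le>j<n. 1 - x\<^sub>j / 2\<close>, which is at most
  \<open>1 / sqrt a\<^sub>n\<close>. So the expectation of \<open>sqrt (a\<^sub>n / K\<^sub>n)\<close> stays bounded, and Fatou's lemma applies.
\<close>

section \<open>Power-law growth of the normalising product\<close>

text \<open>The logarithm of the quotient is a sum of terms \<open>d j\<close>, the change from j to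
  j + 1, and \<open>d j\<close> splits as [ln(1 + q j/j) - q j/j] + (q j - \<alpha>)/j - \<alpha>
  [ln(1 + 1/j) - 1/j]. The brackets are at most 1/j^2 in absolute value and the middle term is
  O(j^(-\<beta>-1)), so \<open>d\<close> is summable and L is the exponential of its sum.\<close>

lemma prod_growth_asymp:
  fixes q :: "nat \<Rightarrow> real" and \<alpha> \<beta> :: real
  assumes q: "\<And>n. n \<ge> 1 \<Longrightarrow> 0 \<le> q n" "\<And>n. n \<ge> 1 \<Longrightarrow> q n \<le> 1"
    and \<beta>: "\<beta> > 0" and O: "(\<lambda>n. q n - \<alpha>) \<in> O(\<lambda>n. real n powr (- \<beta>))"
  obtains L where "L > 0" "(\<lambda>n. (\<Prod>j=1..<n. 1 + q j / real j) / real n powr \<alpha>) \<longlonglongrightarrow> L"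
proof -
  define d where "d j = ln (1 + q j / real j) - \<alpha> * (ln (real (Suc j)) - ln (real j))" for j
  let ?sq = "\<lambda>j. real j powr (-2)"
  \<comment> \<open>Used twice below, with t = q j and with t = 1.\<close>
  have bound: "norm (ln (1 + t / real j) - t / real j) \<le> ?sq j" if "j \<ge> 1" "0 \<le> t" "t \<le> 1" for j t
  proof -
    have "norm (ln (1 + t / real j) - t / real j) \<le> (t / real j)\<^sup>2"
      using that abs_ln_one_plus_x_minus_x_bound_nonneg[of "t / real j"] by (simp add: field_simps)
    also have "\<dots> \<le> (1 / real j)\<^sup>2"
      using that by (intro power_mono divide_right_mono) auto
    also have "\<dots> = ?sq j"
      using that by (simp add: powr_minus powr_numeral field_simps)
    finally show ?thesis .
  qed
  have sum_sq: "summable ?sq"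
    by (simp add: summable_real_powr_iff)
  have s1: "summable (\<lambda>j. ln (1 + q j / real j) - q j / real j)"
    by (rule summable_comparison_test_ev[OF _ sum_sq])
       (use eventually_ge_at_top[of 1] in eventually_elim, rule bound, auto intro: q)
  have s2: "summable (\<lambda>j. ln (1 + 1 / real j) - 1 / real j)"
    by (rule summable_comparison_test_ev[OF _ sum_sq])
       (use eventually_ge_at_top[of 1] in eventually_elim, rule bound, auto)
  have s3: "summable (\<lambda>j. (q j - \<alpha>) / real j)"
  proof (rule summable_comparison_test_bigo)
    show "summable (\<lambda>n. norm (real n powr (- \<beta> - 1)))"
      using \<beta> by (simp add: summable_real_powr_iff)
    have "(\<lambda>j. (q j - \<alpha>) * (1 / real j)) \<in> O(\<lambda>n. real n powr (- \<beta>) * (1 / real n))"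
      by (intro landau_o.big.mult O) simp
    also have "(\<lambda>n. real n powr (- \<beta>) * (1 / real n)) \<in> \<Theta>(\<lambda>n. real n powr (- \<beta> - 1))"
      by (intro bigthetaI_cong)
         (use eventually_gt_at_top[of 0] in eventually_elim, simp add: powr_diff)
    finally show "(\<lambda>j. (q j - \<alpha>) / real j) \<in> O(\<lambda>n. real n powr (- \<beta> - 1))"
      by simp
  qed
  have "summable (\<lambda>j. (ln (1 + q j / real j) - q j / real j) + (q j - \<alpha>) / real j
      - \<alpha> * (ln (1 + 1 / real j) - 1 / real j))"
    by (intro summable_diff summable_add summable_mult s1 s2 s3)
  also have "?this \<longleftrightarrow> summable d"
  proof (intro summable_cong, use eventually_gt_at_top[of 0] in eventually_elim)
    case (elim j)
    hence "ln (real (Suc j)) - ln (real j) = ln (1 + 1 / real j)"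
      using ln_div[of "real (Suc j)" "real j"] by (simp add: add_divide_distrib add.commute)
    thus ?case
      by (simp add: d_def diff_divide_distrib algebra_simps)
  qed
  finally have "summable (\<lambda>j. d (j + 1))"
    by (subst summable_iff_shift)
  hence "(\<lambda>n. \<Sum>j<n. d (j + 1)) \<longlonglongrightarrow> (\<Sum>j. d (j + 1))"
    by (rule summable_LIMSEQ)
  hence "(\<lambda>n. exp (\<Sum>j<n. d (j + 1))) \<longlonglongrightarrow> exp (\<Sum>j. d (j + 1))"
    by (intro tendsto_intros)
  \<comment> \<open>The indexing by \<open>Suc n\<close> starts at 1, where the product is empty and
    the power is 1; \<open>real 0 powr \<alpha>\<close> would be 0.\<close>
  also have "(\<lambda>n. exp (\<Sum>j<n. d (j + 1))) =
      (\<lambda>n. (\<Prod>j=1..<Suc n. 1 + q j / real j) / real (Suc n) powr \<alpha>)"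
  proof
    fix n
    show "exp (\<Sum>j<n. d (j + 1)) = (\<Prod>j=1..<Suc n. 1 + q j / real j) / real (Suc n) powr \<alpha>"
    proof (induction n)
      case (Suc n)
      have "1 + q (Suc n) / real (Suc n) > 0"
        using q(1)[of "Suc n"] by (intro add_pos_nonneg) auto
      hence "exp (d (n + 1)) = (1 + q (Suc n) / real (Suc n)) *
          real (Suc n) powr \<alpha> / real (Suc (Suc n)) powr \<alpha>"
        by (simp add: d_def exp_diff right_diff_distrib powr_def)
      thus ?case
        using Suc by (simp add: exp_add)
    qed simp
  qed
  finally have "(\<lambda>n. (\<Prod>j=1..<n. 1 + q j / real j) / real n powr \<alpha>) \<longlonglongrightarrow> exp (\<Sum>j. d (j + 1))"
    by (rule LIMSEQ_imp_Suc)
  thus ?thesis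
    using that exp_gt_zero by blast
qed

section \<open>From a subsequence to the whole sequence\<close>

text \<open>For N k \<le> n < N (k+1), monotonicity places K n / u n between K (N k) / u (N (k+1))
  and K (N (k+1)) / u (N k). Both ends tend to y because the ratio of neighbouring values of u along
  N tends to 1.\<close>

lemma mono_ratio_tendsto_of_subseq:
  fixes K u :: "nat \<Rightarrow> real" and N :: "nat \<Rightarrow> nat"
  assumes K: "mono K" "\<And>n. 0 \<le> K n" and u: "mono u" "\<And>n. n \<ge> 1 \<Longrightarrow> 0 < u n"
    and N: "strict_mono N" "N 0 \<ge> 1"
    and ratio: "(\<lambda>k. u (N (Suc k)) / u (N k)) \<longlonglongrightarrow> 1"
    and lim: "(\<lambda>k. K (N k) / u (N k)) \<longlonglongrightarrow> y"
  shows "(\<lambda>n. K n / u n) \<longlonglongrightarrow> y"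
proof -
  have N1: "N k \<ge> 1" for k
    using N strict_mono_mono[OF N(1)] monoD[of N 0 k] by fastforce
  have "\<exists>k. N k \<le> n \<and> n < N (Suc k)" if n: "n \<ge> N 0" for n
  proof -
    have "\<exists>k. n < N k"
      using strict_mono_imp_increasing[OF N(1), of "Suc n"] by (intro exI[of _ "Suc n"]) simp
    define k where "k = (LEAST k. n < N k)"
    have k: "n < N k" unfolding k_def using \<open>\<exists>k. n < N k\<close> by (rule LeastI_ex)
    then obtain j where j: "k = Suc j" using n by (cases k) auto
    have "\<not> n < N j" using not_less_Least[of j "\<lambda>k. n < N k"] j k_def by simp
    thus ?thesis using k j by (intro exI[of _ j]) auto
  qed
  then obtain \<kappa> where \<kappa>: "\<And>n. n \<ge> N 0 \<Longrightarrow> N (\<kappa> n) \<le> n" "\<And>n. n \<ge> N 0 \<Longrightarrow> n < N (Suc (\<kappa> n))"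
    by metis
  have \<kappa>_top: "filterlim \<kappa> at_top sequentially"
  proof (subst filterlim_at_top, intro allI)
    fix Z
    show "eventually (\<lambda>n. Z \<le> \<kappa> n) sequentially"
      using eventually_ge_at_top[of "N Z"]
    proof eventually_elim
      case (elim n)
      have "N 0 \<le> n" using elim monoD[OF strict_mono_mono[OF N(1)], of 0 Z] by simp
      hence "N Z < N (Suc (\<kappa> n))" using \<kappa>(2)[of n] elim by simp
      thus ?case using strict_mono_less[OF N(1)] by auto
    qed
  qed
  have lower: "(\<lambda>k. K (N k) / u (N (Suc k))) \<longlonglongrightarrow> y"
  proof -
    have "(\<lambda>k. (K (N k) / u (N k)) / (u (N (Suc k)) / u (N k))) \<longlonglongrightarrow> y / 1"
      by (intro tendsto_divide lim ratio) simp
    moreover have "(K (N k) / u (N k)) / (u (N (Suc k)) / u (N k)) = K (N k) / u (N (Suc k))" for k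
      using u(2)[OF N1[of k]] by simp
    ultimately show ?thesis by (simp only: div_by_1)
  qed
  have upper: "(\<lambda>k. K (N (Suc k)) / u (N k)) \<longlonglongrightarrow> y"
  proof -
    have "(\<lambda>k. (K (N (Suc k)) / u (N (Suc k))) * (u (N (Suc k)) / u (N k))) \<longlonglongrightarrow> y * 1"
      by (intro tendsto_mult LIMSEQ_Suc[OF lim] ratio)
    moreover have "(K (N (Suc k)) / u (N (Suc k))) * (u (N (Suc k)) / u (N k)) = K (N (Suc k)) / u (N k)" for k
      using u(2)[OF N1[of "Suc k"]] by simp
    ultimately show ?thesis by (simp only: mult_1_right)
  qed
  show ?thesis
  proof (rule tendsto_sandwich)
    show "(\<lambda>n. K (N (\<kappa> n)) / u (N (Suc (\<kappa> n)))) \<longlonglongrightarrow> y"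
      using filterlim_compose[OF lower \<kappa>_top] .
    show "(\<lambda>n. K (N (Suc (\<kappa> n))) / u (N (\<kappa> n))) \<longlonglongrightarrow> y"
      using filterlim_compose[OF upper \<kappa>_top] .
    show "\<forall>\<^sub>F n in sequentially. K (N (\<kappa> n)) / u (N (Suc (\<kappa> n))) \<le> K n / u n"
      using eventually_ge_at_top[of "N 0"]
    proof eventually_elim
      case (elim n)
      show ?case
        using \<kappa>[OF elim] N elim K u(2)[of n] monoD[OF K(1), of "N (\<kappa> n)" n]
          monoD[OF u(1), of n "N (Suc (\<kappa> n))"]
        by (intro frac_le) auto
    qed
    show "\<forall>\<^sub>F n in sequentially. K n / u n \<le> K (N (Suc (\<kappa> n))) / u (N (\<kappa> n))"
      using eventually_ge_at_top[of "N 0"]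
    proof eventually_elim
      case (elim n)
      show ?case
        using \<kappa>[OF elim] K u(2)[OF N1[of "\<kappa> n"]] monoD[OF K(1), of n "N (Suc (\<kappa> n))"]
          monoD[OF u(1), of "N (\<kappa> n)" n]
        by (intro frac_le) auto
    qed
  qed
qed

section \<open>The test function for positivity\<close>

text \<open>
  For \<open>k \<ge> 1\<close> this is \<open>\<Gamma>(k - 1/2) / (\<Gamma>(1/2) \<Gamma>(k))\<close>, an eigenfunction with eigenvalue \<open>- 1/2\<close> of the operator
  \<open>f \<mapsto> (\<lambda>k. k (f (k + 1) - f k))\<close> that governs the conditional expectations of functions of \<open>K\<^sub>n\<close>.
\<close>

definition half_weight :: "nat \<Rightarrow> real" where
  "half_weight k = (\<Prod>j=1..<k. 1 - 1 / (2 * real j))"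

lemma half_weight_Suc:
  assumes "k \<ge> 1"
  shows "half_weight (Suc k) = half_weight k - half_weight k / (2 * real k)"
  using assms by (simp add: half_weight_def algebra_simps)

lemma half_weight_nonneg: "0 \<le> half_weight k"
  unfolding half_weight_def by (intro prod_nonneg) (auto simp: field_simps)

lemma half_weight_le_1: "half_weight k \<le> 1"
  unfolding half_weight_def by (intro prod_le_1) (auto simp: field_simps)

text \<open>The induction uses the factor k - 1: the product
  \<open>(half_weight k)\<^sup>2 * (real k - 1)\<close> is nondecreasing from its value 1/4 at k =
  2, because (1 - 1/(2k))^2 k = k - 1 + 1/(4k). With the factor k the product would decrease and
  could not be bounded below this way.\<close>

lemma half_weight_ge:
  assumes "k \<ge> 1"
  shows "1 / (2 * sqrt (real k)) \<le> half_weight k"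
proof -
  have ge_2: "1 / 4 \<le> (half_weight k)\<^sup>2 * (real k - 1)" if "k \<ge> 2" for k
    using that
  proof (induction k rule: dec_induct)
    case base
    show ?case by (simp add: half_weight_def numeral_2_eq_2 power2_eq_square)
  next
    case (step k)
    have "real k - 1 \<le> (1 - 1 / (2 * real k))\<^sup>2 * real k"
      using step.hyps by (simp add: power2_eq_square field_simps)
    hence "(half_weight k)\<^sup>2 * (real k - 1) \<le> (half_weight k)\<^sup>2 * ((1 - 1 / (2 * real k))\<^sup>2 * real k)"
      by (rule mult_left_mono) simp
    also have "\<dots> = (half_weight (Suc k))\<^sup>2 * (real (Suc k) - 1)"
      using step.hyps by (simp add: half_weight_def power_mult_distrib)
    finally show ?case using step.IH by linarith
  qed
  have *: "1 / 4 \<le> (half_weight k)\<^sup>2 * real k"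
  proof (cases "k = 1")
    case False
    hence "1 / 4 \<le> (half_weight k)\<^sup>2 * (real k - 1)"
      using assms ge_2[of k] by simp
    also have "\<dots> \<le> (half_weight k)\<^sup>2 * real k"
      by (intro mult_left_mono) auto
    finally show ?thesis .
  qed (simp add: half_weight_def)
  have "1 / (2 * sqrt (real k)) = sqrt (1 / 4 / real k)"
    by (simp add: real_sqrt_divide real_sqrt_mult)
  also have "\<dots> \<le> sqrt ((half_weight k)\<^sup>2)"
    using * assms by (intro real_sqrt_le_mono) (simp add: field_simps)
  also have "\<dots> = half_weight k"
    by (simp add: half_weight_nonneg)
  finally show ?thesis .
qed

text \<open>On [0, 1], 1 - x/2 lies below (1 + x)^(-1/2), with which it agrees to first order. This
  is the factorwise comparison behind \<open>sqrt_growth_le\<close>.\<close>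

lemma sq_one_minus_half_mult_le_1:
  fixes x :: real
  assumes "0 \<le> x" "x \<le> 1"
  shows "(1 - x / 2)\<^sup>2 * (1 + x) \<le> 1"
proof -
  have "(1 - x / 2)\<^sup>2 * (1 + x) = 1 - x\<^sup>2 * (3 - x) / 4"
    by (simp add: power2_eq_square field_simps)
  also have "\<dots> \<le> 1" using assms by simp
  finally show ?thesis .
qed

section \<open>Colour counts and step probabilities\<close>

lemma Kcount_Suc: "Kcount s (Suc n) c = Kcount s n c + (if s (Suc n) = c then 1 else 0)"
proof -
  have "{k \<in> {1..Suc n}. s k = c} =
      (if s (Suc n) = c then insert (Suc n) {k \<in> {1..n}. s k = c} else {k \<in> {1..n}. s k = c})"
    by (auto simp: le_Suc_eq)
  thus ?thesis
    by (simp add: Kcount_def)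
qed

lemma Kcount_mono: "m \<le> n \<Longrightarrow> Kcount s m c \<le> Kcount s n c"
  unfolding Kcount_def by (rule card_mono) auto

lemma Kcount_le: "Kcount s n c \<le> n"
  unfolding Kcount_def by (rule order.trans[OF card_mono[of "{1..n}"]]) auto

lemma Kcount_cong: "(\<And>k. k \<in> {1..n} \<Longrightarrow> s k = t k) \<Longrightarrow> Kcount s n c = Kcount t n c"
  unfolding Kcount_def by (rule arg_cong[of _ _ card]) auto

lemma Kcount_pos_iff: "Kcount s n c > 0 \<longleftrightarrow> c \<in> s ` {1..n}"
  by (auto simp: Kcount_def card_gt_0_iff)

text \<open>The times 1..n are partitioned by the colour registered. For linear F this makes the
  total weight the deterministic number \<rho> n, so draw probabilities are linear in the
  count.\<close>

lemma sum_Kcount: "(\<Sum>c\<in>s ` {1..n}. Kcount s n c) = n"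
proof -
  have "(\<Sum>c\<in>s ` {1..n}. Kcount s n c) = card (\<Union>c\<in>s ` {1..n}. {k \<in> {1..n}. s k = c})"
    unfolding Kcount_def by (rule card_UN_disjoint[symmetric]) auto
  also have "(\<Union>c\<in>s ` {1..n}. {k \<in> {1..n}. s k = c}) = {1..n}"
    by auto
  finally show ?thesis by simp
qed

lemma step_prob_cong:
  assumes "b (k - 1) = b' (k - 1)" "\<And>j. j \<in> {1..k} \<Longrightarrow> s j = s' j" "k \<ge> 1"
  shows "step_prob F b s k = step_prob F b' s' k"
proof -
  have im: "s ` {1..k-1} = s' ` {1..k-1}"
    using assms by (intro image_cong) auto
  have K: "Kcount s (k-1) = Kcount s' (k-1)"
    using assms by (intro ext Kcount_cong) auto
  have "s k = s' k" using assms by simp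
  thus ?thesis
    unfolding step_prob_def Let_def im K assms(1) by simp
qed

section \<open>Conditioning on a discrete random variable\<close>

text \<open>Here r is the conditional probability of A given H. The law of H restricted to A and the
  law of H with density r agree on points, hence as measures on a countable type; equality of the
  measures gives the identity for every G, integrable or not.\<close>

lemma integral_countable_valued_eq:
  fixes H :: "'a \<Rightarrow> 'h::countable" and G r :: "'h \<Rightarrow> real"
  assumes "prob_space M" and H: "H \<in> measurable M (count_space UNIV)" and A: "A \<in> sets M"
    and r: "\<And>h. 0 \<le> r h"
    and eq: "\<And>h. measure M {\<omega> \<in> space M. H \<omega> = h \<and> \<omega> \<in> A} = r h * measure M {\<omega> \<in> space M. H \<omega> = h}"
  shows "(\<integral>\<omega>. indicator A \<omega> * G (H \<omega>) \<partial>M) = (\<integral>\<omega>. r (H \<omega>) * G (H \<omega>) \<partial>M)"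
proof -
  interpret prob_space M by fact
  note [measurable] = H A
  let ?\<mu> = "distr (density M (\<lambda>\<omega>. ennreal (indicator A \<omega>))) (count_space UNIV) H"
  let ?\<nu> = "density (distr M (count_space UNIV) H) (\<lambda>h. ennreal (r h))"
  have "?\<mu> = ?\<nu>"
  proof (rule measure_eqI_countable[where A = UNIV])
    fix h :: 'h
    have "emeasure ?\<mu> {h} = emeasure (density M (\<lambda>\<omega>. ennreal (indicator A \<omega>))) (H -` {h} \<inter> space M)"
      by (subst emeasure_distr) auto
    also have "\<dots> = (\<integral>\<^sup>+\<omega>. ennreal (indicator A \<omega>) * indicator (H -` {h} \<inter> space M) \<omega> \<partial>M)"
      by (subst emeasure_density) auto
    also have "\<dots> = (\<integral>\<^sup>+\<omega>. indicator {\<omega> \<in> space M. H \<omega> = h \<and> \<omega> \<in> A} \<omega> \<partial>M)"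
      by (intro nn_integral_cong) (auto simp: indicator_def)
    also have "\<dots> = ennreal (r h) * emeasure M {\<omega> \<in> space M. H \<omega> = h}"
      using eq[of h] by (simp add: emeasure_eq_measure ennreal_mult r)
    also have "{\<omega> \<in> space M. H \<omega> = h} = H -` {h} \<inter> space M"
      by auto
    also have "ennreal (r h) * emeasure M (H -` {h} \<inter> space M) = emeasure ?\<nu> {h}"
      by (simp add: emeasure_density emeasure_distr nn_integral_cmult_indicator)
    finally show "emeasure ?\<mu> {h} = emeasure ?\<nu> {h}" .
  qed auto
  hence "integral\<^sup>L ?\<mu> G = integral\<^sup>L ?\<nu> G"
    by simp
  thus ?thesis
    by (simp add: integral_distr integral_density r)
qed

section \<open>Cylinder probabilities of the linear urn\<close>

locale linear_urn =
  fixes M :: "'a measure" and \<rho> :: real and pn :: "nat \<Rightarrow> real"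
    and B :: "nat \<Rightarrow> 'a \<Rightarrow> bool" and S :: "nat \<Rightarrow> 'a \<Rightarrow> nat"
  assumes \<rho>_pos: "\<rho> > 0"
    and pn: "\<And>n. n \<ge> 1 \<Longrightarrow> 0 < pn n" "\<And>n. n \<ge> 1 \<Longrightarrow> pn n < 1"
    and urn: "triggered_urn M (\<lambda>x. \<rho> * x) pn B S"
begin

sublocale prob_space M
  using urn unfolding triggered_urn_def by blast

lemma measurable_B [measurable]: "B i \<in> measurable M (count_space UNIV)"
  and measurable_S [measurable]: "S i \<in> measurable M (count_space UNIV)"
  using urn unfolding triggered_urn_def by blast+

text \<open>The trigger \<open>B n\<close> is left out, unlike in \<open>triggered_urn\<close>: the
  colour at time n depends on \<open>B (n - 1)\<close>, so these coordinates are exactly what is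
  known before step n + 1.\<close>

definition weight :: "nat \<Rightarrow> (nat \<Rightarrow> bool) \<Rightarrow> (nat \<Rightarrow> nat) \<Rightarrow> real" where
  "weight n b s = (\<Prod>i<n. bern_prob pn i (b i)) * (\<Prod>k\<in>{1..n}. step_prob (\<lambda>x. \<rho> * x) b s k)"

definition cylinder :: "nat \<Rightarrow> (nat \<Rightarrow> bool) \<Rightarrow> (nat \<Rightarrow> nat) \<Rightarrow> 'a set" where
  "cylinder n b s = {\<omega> \<in> space M. (\<forall>i<n. B i \<omega> = b i) \<and> (\<forall>k\<in>{1..n}. S k \<omega> = s k)}"

lemma cylinder_sets [measurable]: "cylinder n b s \<in> sets M"
  unfolding cylinder_def by measurable

lemma cylinder_Suc:
  "cylinder (Suc n) b s = cylinder n b s \<inter> {\<omega> \<in> space M. B n \<omega> = b n \<and> S (Suc n) \<omega> = s (Suc n)}"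
  unfolding cylinder_def by (simp add: All_less_Suc atLeastAtMostSuc_conv) auto

lemma cylinder_cong:
  assumes "\<And>i. i < n \<Longrightarrow> b i = b' i" "\<And>k. k \<in> {1..n} \<Longrightarrow> s k = s' k"
  shows "cylinder n b s = cylinder n b' s'"
  unfolding cylinder_def using assms by auto

lemma weight_Suc:
  "weight (Suc n) b s =
     weight n b s * (bern_prob pn n (b n) * step_prob (\<lambda>x. \<rho> * x) b s (Suc n))"
  by (simp add: weight_def)

lemma weight_cong:
  assumes "\<And>i. i < n \<Longrightarrow> b i = b' i" "\<And>k. k \<in> {1..n} \<Longrightarrow> s k = s' k"
  shows "weight n b s = weight n b' s'"
proof -
  have "step_prob (\<lambda>x. \<rho> * x) b s k = step_prob (\<lambda>x. \<rho> * x) b' s' k" if "k \<in> {1..n}" for k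
    using that assms by (intro step_prob_cong) auto
  thus ?thesis
    unfolding weight_def using assms by (intro arg_cong2[of _ _ _ _ "(*)"] prod.cong) auto
qed

text \<open>The defining identity of the urn also fixes \<open>B n\<close>; adding it over the two
  values of \<open>B n\<close> removes the last Bernoulli factor, whose values sum to 1.\<close>

lemma prob_cylinder: "prob (cylinder n b s) = weight n b s"
proof -
  let ?E = "\<lambda>x. {\<omega> \<in> space M. (\<forall>i\<le>n. B i \<omega> = (b(n := x)) i) \<and> (\<forall>k\<in>{1..n}. S k \<omega> = s k)}"
  have E: "prob (?E x) = bern_prob pn n x * weight n b s" for x
  proof -
    have "prob (?E x) = (\<Prod>i\<le>n. bern_prob pn i ((b(n := x)) i)) *
        (\<Prod>k\<in>{1..n}. step_prob (\<lambda>x. \<rho> * x) (b(n := x)) s k)"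
      using urn unfolding triggered_urn_def by blast
    also have "\<dots> = bern_prob pn n x * weight n (b(n := x)) s"
      unfolding weight_def lessThan_Suc_atMost[symmetric] by simp
    also have "weight n (b(n := x)) s = weight n b s"
      by (rule weight_cong) auto
    finally show ?thesis .
  qed
  have E': "?E x = cylinder n b s \<inter> {\<omega> \<in> space M. B n \<omega> = x}" for x
    unfolding cylinder_def by (auto simp: le_less)
  have split: "cylinder n b s = ?E True \<union> ?E False"
    unfolding E' by (auto simp: cylinder_def)
  have "prob (cylinder n b s) = prob (?E True) + prob (?E False)"
    by (subst split, unfold E', rule finite_measure_Union) auto
  also have "\<dots> = (bern_prob pn n True + bern_prob pn n False) * weight n b s"
    unfolding E by (simp only: distrib_right)
  also have "\<dots> = weight n b s"
    by (simp add: bern_prob_def)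
  finally show ?thesis .
qed

text \<open>Each trigger must add the label one above the number of present colours, so by induction
  no gaps arise. This shows that a new label is never already in use, and it links \<open>Cn\<close>
  to the registered colours.\<close>

lemma weight_nonzero_imp_colours:
  assumes "weight n b s \<noteq> 0"
  shows "s ` {1..n} = {1..card {i. i < n \<and> b i}}"
  using assms
proof (induction n)
  case (Suc n)
  let ?C = "card {i. i < n \<and> b i}"
  have IH: "s ` {1..n} = {1..?C}"
    using Suc by (auto simp: weight_Suc)
  have step: "step_prob (\<lambda>x. \<rho> * x) b s (Suc n) \<noteq> 0"
    using Suc.prems by (auto simp: weight_Suc)
  have im: "s ` {1..Suc n} = insert (s (Suc n)) (s ` {1..n})"
    by (auto simp: atLeastAtMostSuc_conv)
  have card: "{i. i < Suc n \<and> b i} = (if b n then insert n {i. i < n \<and> b i} else {i. i < n \<and> b i})"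
    by (auto simp: less_Suc_eq)
  show ?case
  proof (cases "b n")
    case True
    hence "s (Suc n) = Suc ?C"
      using step IH by (simp add: step_prob_def Let_def split: if_splits)
    thus ?thesis
      using True by (simp only: im card IH) (auto simp: atLeastAtMostSuc_conv)
  next
    case False
    hence "s (Suc n) \<in> s ` {1..n}"
      using step by (simp add: step_prob_def Let_def split: if_splits)
    thus ?thesis
      using False by (simp only: im card IH) auto
  qed
qed auto

definition rate :: "nat \<Rightarrow> real" where
  "rate n = (1 - pn n) / real n"

lemma rate_pos: "n \<ge> 1 \<Longrightarrow> 0 < rate n"
  using pn[of n] by (simp add: rate_def)

lemma rate_le: "n \<ge> 1 \<Longrightarrow> rate n \<le> 1 / real n"
  using pn[of n] by (simp add: rate_def divide_right_mono)

lemma rate_le_1: "n \<ge> 1 \<Longrightarrow> rate n \<le> 1"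
  using rate_le[of n] by (rule order.trans) auto

text \<open>Split by the value of \<open>B n\<close>. A trigger creates a label different from the
  present colour c and contributes 0; a draw contributes (1 - p_n) times the share of c, which is
  its count over n.\<close>

lemma prob_cylinder_next:
  assumes "c \<in> s ` {1..n}"
  shows "prob (cylinder n b s \<inter> {\<omega> \<in> space M. S (Suc n) \<omega> = c}) =
    rate n * real (Kcount s n c) * prob (cylinder n b s)"
proof -
  let ?E = "\<lambda>x. cylinder (Suc n) (b(n := x)) (s(Suc n := c))"
  have n: "n \<ge> 1" using assms by auto
  have E: "prob (?E x) = weight n b s * (bern_prob pn n x *
      step_prob (\<lambda>x. \<rho> * x) (b(n := x)) (s(Suc n := c)) (Suc n))" for x
  proof -
    have "weight n (b(n := x)) (s(Suc n := c)) = weight n b s"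
      by (rule weight_cong) auto
    thus ?thesis by (simp add: prob_cylinder weight_Suc)
  qed
  have E': "?E x = cylinder n b s \<inter> {\<omega> \<in> space M. B n \<omega> = x \<and> S (Suc n) \<omega> = c}" for x
  proof -
    have "cylinder n (b(n := x)) (s(Suc n := c)) = cylinder n b s"
      by (rule cylinder_cong) auto
    thus ?thesis by (simp add: cylinder_Suc)
  qed
  have D: "s(Suc n := c) ` {1..n} = s ` {1..n}"
    by (intro image_cong) auto
  have K: "Kcount (s(Suc n := c)) n d = Kcount s n d" for d
    by (rule Kcount_cong) auto
  have split: "cylinder n b s \<inter> {\<omega> \<in> space M. S (Suc n) \<omega> = c} = ?E True \<union> ?E False"
    unfolding E' by auto
  have "prob (cylinder n b s \<inter> {\<omega> \<in> space M. S (Suc n) \<omega> = c}) = prob (?E True) + prob (?E False)"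
    unfolding split by (rule finite_measure_Union) (auto simp: E')
  also have "\<dots> = rate n * real (Kcount s n c) * prob (cylinder n b s)"
  proof (cases "weight n b s = 0")
    case True
    thus ?thesis unfolding E prob_cylinder[of n] by simp
  next
    case False
    define C where "C = card {i. i < n \<and> b i}"
    have C: "s ` {1..n} = {1..C}"
      using weight_nonzero_imp_colours[OF False] unfolding C_def .
    \<comment> \<open>The labels present are 1..C by positivity of the weight, so the new label C +
      1 is not c.\<close>
    have "c \<noteq> card (s ` {1..n}) + 1"
      using assms unfolding C by auto
    hence "step_prob (\<lambda>x. \<rho> * x) (b(n := True)) (s(Suc n := c)) (Suc n) = 0"
      unfolding step_prob_def Let_def diff_Suc_1 D fun_upd_same by simp
    moreover have "step_prob (\<lambda>x. \<rho> * x) (b(n := False)) (s(Suc n := c)) (Suc n) =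
        real (Kcount s n c) / real n"
    proof -
      have "(\<Sum>d\<in>s ` {1..n}. \<rho> * real (Kcount s n d)) = \<rho> * real n"
        unfolding sum_distrib_left[symmetric] of_nat_sum[symmetric] sum_Kcount ..
      thus ?thesis
        unfolding step_prob_def Let_def diff_Suc_1 D K fun_upd_same
        using assms \<rho>_pos by simp
    qed
    ultimately show ?thesis
      unfolding E prob_cylinder[of n] using n by (simp add: rate_def bern_prob_def)
  qed
  finally show ?thesis .
qed

section \<open>Histories, adapted variables and one-step expectations\<close>

text \<open>Lists make the value type countable, so that conditioning reduces to a comparison on
  single histories.\<close>

definition hist :: "nat \<Rightarrow> 'a \<Rightarrow> bool list \<times> nat list" where
  "hist n \<omega> = (map (\<lambda>i. B i \<omega>) [0..<n], map (\<lambda>k. S k \<omega>) [1..<Suc n])"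

lemma hist_eq_iff:
  "hist n \<omega> = hist n \<omega>' \<longleftrightarrow> (\<forall>i<n. B i \<omega> = B i \<omega>') \<and> (\<forall>k\<in>{1..n}. S k \<omega> = S k \<omega>')"
  unfolding hist_def prod.inject map_eq_conv set_upt by (auto simp: Suc_le_eq less_Suc_eq_le)

lemma hist_vimage:
  "{\<omega> \<in> space M. hist n \<omega> = hist n \<omega>'} = cylinder n (\<lambda>i. B i \<omega>') (\<lambda>k. S k \<omega>')"
  by (auto simp: cylinder_def hist_eq_iff)

lemma measurable_hist [measurable]: "hist n \<in> measurable M (count_space UNIV)"
proof (rule measurable_count_space_eq2_countable[THEN iffD2], intro conjI ballI)
  fix h show "hist n -` {h} \<inter> space M \<in> sets M"
  proof (cases "\<exists>\<omega>'. hist n \<omega>' = h")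
    case True
    then obtain \<omega>' where "h = hist n \<omega>'" by auto
    hence "hist n -` {h} \<inter> space M = cylinder n (\<lambda>i. B i \<omega>') (\<lambda>k. S k \<omega>')"
      unfolding hist_vimage[symmetric] by blast
    thus ?thesis by simp
  next
    case False
    hence "hist n -` {h} \<inter> space M = {}" by blast
    thus ?thesis by simp
  qed
qed auto

text \<open>A pointwise substitute for measurability with respect to S_1, ..., S_n: such a variable
  factors through \<open>hist n\<close>, and since \<open>hist n\<close> is discrete, measurability
  follows without further conditions.\<close>

definition adapted :: "nat \<Rightarrow> ('a \<Rightarrow> 'b) \<Rightarrow> bool" where
  "adapted n X \<longleftrightarrow> (\<forall>\<omega> \<omega>'. (\<forall>k\<in>{1..n}. S k \<omega> = S k \<omega>') \<longrightarrow> X \<omega> = X \<omega>')"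

lemma adapted_factor:
  assumes "adapted n X"
  obtains G where "\<And>\<omega>. X \<omega> = G (hist n \<omega>)"
proof (rule that[of "\<lambda>h. X (SOME \<omega>. hist n \<omega> = h)"])
  fix \<omega>
  define \<omega>' where "\<omega>' = (SOME \<omega>'. hist n \<omega>' = hist n \<omega>)"
  have "hist n \<omega>' = hist n \<omega>"
    unfolding \<omega>'_def by (rule someI[where x = \<omega>]) (rule refl)
  hence "\<forall>k\<in>{1..n}. S k \<omega> = S k \<omega>'"
    unfolding hist_eq_iff by simp
  hence "X \<omega> = X \<omega>'"
    using assms unfolding adapted_def by blast
  thus "X \<omega> = X (SOME \<omega>'. hist n \<omega>' = hist n \<omega>)"
    unfolding \<omega>'_def .
qed

lemma measurable_adapted:
  fixes X :: "'a \<Rightarrow> real"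
  assumes "adapted n X"
  shows "X \<in> borel_measurable M"
proof -
  obtain G where "\<And>\<omega>. X \<omega> = G (hist n \<omega>)"
    using adapted_factor[OF assms] by metis
  hence "X = (\<lambda>\<omega>. G (hist n \<omega>))" by auto
  also have "\<dots> \<in> borel_measurable M" by measurable
  finally show ?thesis .
qed

lemma adapted_Kn: "m \<le> n \<Longrightarrow> adapted n (Kn S m c)"
  unfolding adapted_def Kn_def by (intro allI impI Kcount_cong) auto

lemma adapted_comp: "adapted n X \<Longrightarrow> adapted n (\<lambda>\<omega>. f (X \<omega>))"
  unfolding adapted_def by (intro allI impI arg_cong[of _ _ f]) blast

lemma adapted_comp2: "adapted n X \<Longrightarrow> adapted n Y \<Longrightarrow> adapted n (\<lambda>\<omega>. f (X \<omega>) (Y \<omega>))"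
  unfolding adapted_def by (intro allI impI arg_cong2[of _ _ _ _ f]) blast+

lemma measurable_Kn [measurable]: "Kn S n c \<in> measurable M (count_space UNIV)"
proof -
  have "Kn S n c = (\<lambda>\<omega>. \<Sum>k\<in>{1..n}. if S k \<omega> = c then 1 else 0)"
    by (auto simp: Kn_def Kcount_def fun_eq_iff sum.If_cases Int_def)
  also have "\<dots> \<in> measurable M (count_space UNIV)" by measurable
  finally show ?thesis .
qed

text \<open>Given the history, a present colour c is registered next with probability
  \<open>rate n\<close> times its count. Requiring a positive count excludes the first appearance of
  c, which is caused by a trigger; the right side vanishes there too.\<close>

lemma integral_next_colour:
  fixes X :: "'a \<Rightarrow> real"
  assumes "adapted n X"
  shows "(\<integral>\<omega>. X \<omega> * of_bool (S (Suc n) \<omega> = c \<and> Kn S n c \<omega> > 0) \<partial>M) =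
    rate n * (\<integral>\<omega>. X \<omega> * real (Kn S n c \<omega>) \<partial>M)"
proof -
  let ?A = "{\<omega> \<in> space M. S (Suc n) \<omega> = c \<and> Kn S n c \<omega> > 0}"
  obtain G where G: "\<And>\<omega>. X \<omega> = G (hist n \<omega>)"
    using adapted_factor[OF assms] by metis
  obtain k where k: "\<And>\<omega>. Kn S n c \<omega> = k (hist n \<omega>)"
    using adapted_factor[OF adapted_Kn[OF order.refl, of n c]] by metis
  \<comment> \<open>For n = 0 the rate is 0 by the convention for division by zero.\<close>
  have rate0: "rate n \<ge> 0"
    using rate_pos[of n] by (cases "n = 0") (auto simp: rate_def)
  have "(\<integral>\<omega>. indicator ?A \<omega> * G (hist n \<omega>) \<partial>M) =
      (\<integral>\<omega>. (rate n * real (k (hist n \<omega>))) * G (hist n \<omega>) \<partial>M)"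
  proof (rule integral_countable_valued_eq)
    fix h
    show "prob {\<omega> \<in> space M. hist n \<omega> = h \<and> \<omega> \<in> ?A} =
        rate n * real (k h) * prob {\<omega> \<in> space M. hist n \<omega> = h}"
    proof (cases "\<exists>\<omega>'. hist n \<omega>' = h \<and> Kn S n c \<omega>' > 0")
      case True
      then obtain \<omega>' where h: "h = hist n \<omega>'" and K: "Kn S n c \<omega>' > 0" by auto
      let ?C = "cylinder n (\<lambda>i. B i \<omega>') (\<lambda>k. S k \<omega>')"
      have "{\<omega> \<in> space M. hist n \<omega> = h \<and> \<omega> \<in> ?A} = ?C \<inter> {\<omega> \<in> space M. S (Suc n) \<omega> = c}"
        using K by (auto simp: h hist_vimage[symmetric] k)
      moreover have "prob \<dots> = rate n * real (Kcount (\<lambda>k. S k \<omega>') n c) * prob ?C"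
        using K by (intro prob_cylinder_next) (simp add: Kn_def Kcount_pos_iff)
      ultimately show ?thesis
        unfolding h hist_vimage k[symmetric] by (simp add: Kn_def)
    next
      case False
      \<comment> \<open>Both sides are 0: if h is attained, c is absent from it and
        \<open>k h = 0\<close>; otherwise both events are empty.\<close>
      show ?thesis
      proof (cases "\<exists>\<omega>'. hist n \<omega>' = h")
        case True
        then have "k h = 0" using False k by auto
        moreover have "{\<omega> \<in> space M. hist n \<omega> = h \<and> \<omega> \<in> ?A} = {}" using False by blast
        ultimately show ?thesis by (metis measure_empty mult_zero_left mult_zero_right of_nat_0)
      next
        case False': False
        hence "{\<omega> \<in> space M. hist n \<omega> = h \<and> \<omega> \<in> ?A} = {}" "{\<omega> \<in> space M. hist n \<omega> = h} = {}"
          by blast+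
        thus ?thesis by (metis measure_empty mult_zero_right)
      qed
    qed
  next
    show "?A \<in> sets M" by measurable
  qed (use rate0 in \<open>simp_all add: prob_space_axioms measurable_hist\<close>)
  moreover have "(\<integral>\<omega>. X \<omega> * of_bool (S (Suc n) \<omega> = c \<and> Kn S n c \<omega> > 0) \<partial>M) =
      (\<integral>\<omega>. indicator ?A \<omega> * G (hist n \<omega>) \<partial>M)"
    by (intro Bochner_Integration.integral_cong) (simp_all add: G[symmetric] indicator_def)
  ultimately show ?thesis
    by (simp add: G[symmetric] k[symmetric] mult_ac flip: integral_mult_right_zero)
qed

text \<open>There are only countably many histories of length n, so almost surely the observed one
  has positive probability and \<open>weight_nonzero_imp_colours\<close> applies to it.\<close>

lemma AE_colours: "AE \<omega> in M. \<forall>n. (\<lambda>k. S k \<omega>) ` {1..n} = {1..Cn B n \<omega>}"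
proof (subst AE_all_countable, intro allI)
  fix n
  have "AE \<omega> in M. \<forall>h. hist n \<omega> = h \<longrightarrow> prob {\<omega> \<in> space M. hist n \<omega> = h} \<noteq> 0"
  proof (subst AE_all_countable, intro allI)
    fix h
    show "AE \<omega> in M. hist n \<omega> = h \<longrightarrow> prob {\<omega> \<in> space M. hist n \<omega> = h} \<noteq> 0"
    proof (cases "prob {\<omega> \<in> space M. hist n \<omega> = h} = 0")
      case True
      hence "AE \<omega> in M. \<omega> \<notin> {\<omega> \<in> space M. hist n \<omega> = h}"
        by (subst prob_eq_0[symmetric]) auto
      thus ?thesis
        by (rule AE_mp) (rule AE_I2, auto)
    qed simp
  qed
  thus "AE \<omega> in M. (\<lambda>k. S k \<omega>) ` {1..n} = {1..Cn B n \<omega>}"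
  proof eventually_elim
    case (elim \<omega>)
    hence "weight n (\<lambda>i. B i \<omega>) (\<lambda>k. S k \<omega>) \<noteq> 0"
      by (simp add: hist_vimage prob_cylinder)
    thus ?case
      unfolding Cn_def by (rule weight_nonzero_imp_colours)
  qed
qed

lemma Kn_mono: "m \<le> n \<Longrightarrow> Kn S m c \<omega> \<le> Kn S n c \<omega>"
  unfolding Kn_def by (rule Kcount_mono)

lemma adapted_mono: "adapted m X \<Longrightarrow> m \<le> n \<Longrightarrow> adapted n X"
  unfolding adapted_def by (meson atLeastAtMost_iff order.trans)

lemma integrable_mult_Kn:
  fixes f :: "nat \<Rightarrow> real"
  assumes Y: "adapted n Y" "\<And>\<omega>. \<bar>Y \<omega>\<bar> \<le> C"
  shows "integrable M (\<lambda>\<omega>. Y \<omega> * f (Kn S k c \<omega>))"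
proof (rule integrable_const_bound[where B = "C * Max ((\<lambda>x. \<bar>f x\<bar>) ` {..k})"])
  have C: "0 \<le> C"
    using Y(2) abs_ge_zero order.trans by blast
  show "AE \<omega> in M. norm (Y \<omega> * f (Kn S k c \<omega>)) \<le> C * Max ((\<lambda>x. \<bar>f x\<bar>) ` {..k})"
  proof (rule AE_I2)
    fix \<omega>
    have "Kn S k c \<omega> \<le> k"
      unfolding Kn_def by (rule Kcount_le)
    hence "\<bar>f (Kn S k c \<omega>)\<bar> \<le> Max ((\<lambda>x. \<bar>f x\<bar>) ` {..k})"
      by (intro Max_ge) auto
    thus "norm (Y \<omega> * f (Kn S k c \<omega>)) \<le> C * Max ((\<lambda>x. \<bar>f x\<bar>) ` {..k})"
      unfolding real_norm_def abs_mult by (intro mult_mono Y C) auto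
  qed
  show "(\<lambda>\<omega>. Y \<omega> * f (Kn S k c \<omega>)) \<in> borel_measurable M"
    using measurable_adapted[OF Y(1)] by measurable
qed

text \<open>The count moves from K to K + 1 exactly when c is registered. Since Y vanishes where c
  is absent, only repeated draws of c matter, and their probability is known from
  \<open>integral_next_colour\<close>.\<close>

lemma expectation_next:
  fixes f :: "nat \<Rightarrow> real"
  assumes Y: "adapted n Y" "\<And>\<omega>. \<bar>Y \<omega>\<bar> \<le> C" "\<And>\<omega>. Kn S n c \<omega> = 0 \<Longrightarrow> Y \<omega> = 0"
  shows "expectation (\<lambda>\<omega>. Y \<omega> * f (Kn S (Suc n) c \<omega>)) =
    expectation (\<lambda>\<omega>. Y \<omega> * f (Kn S n c \<omega>)) +
    rate n * expectation (\<lambda>\<omega>. Y \<omega> * (real (Kn S n c \<omega>) * (f (Suc (Kn S n c \<omega>)) - f (Kn S n c \<omega>))))"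
proof -
  let ?D = "\<lambda>\<omega>. Y \<omega> * (f (Suc (Kn S n c \<omega>)) - f (Kn S n c \<omega>))"
  have "adapted n (\<lambda>\<omega>. f (Suc (Kn S n c \<omega>)) - f (Kn S n c \<omega>))"
    by (rule adapted_comp[OF adapted_Kn[OF order.refl]])
  hence "adapted n ?D"
    by (rule adapted_comp2[OF Y(1)])
  note colour = integral_next_colour[OF this, of c]
  have "Y \<omega> * f (Kn S (Suc n) c \<omega>) - Y \<omega> * f (Kn S n c \<omega>) =
      ?D \<omega> * of_bool (S (Suc n) \<omega> = c \<and> Kn S n c \<omega> > 0)" for \<omega>
    using Y(3)[of \<omega>] by (cases "Kn S n c \<omega> = 0") (auto simp: Kn_def Kcount_Suc right_diff_distrib)
  hence "expectation (\<lambda>\<omega>. Y \<omega> * f (Kn S (Suc n) c \<omega>) - Y \<omega> * f (Kn S n c \<omega>)) =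
      rate n * expectation (\<lambda>\<omega>. ?D \<omega> * real (Kn S n c \<omega>))"
    by (simp only: colour)
  also have "expectation (\<lambda>\<omega>. Y \<omega> * f (Kn S (Suc n) c \<omega>) - Y \<omega> * f (Kn S n c \<omega>)) =
      expectation (\<lambda>\<omega>. Y \<omega> * f (Kn S (Suc n) c \<omega>)) - expectation (\<lambda>\<omega>. Y \<omega> * f (Kn S n c \<omega>))"
    by (intro Bochner_Integration.integral_diff integrable_mult_Kn[OF Y(1,2)])
  finally show ?thesis
    by (simp add: mult_ac)
qed

section \<open>The martingale property\<close>

definition growth :: "nat \<Rightarrow> real" where
  "growth n = (\<Prod>j=1..<n. 1 + rate j)"

lemma growth_Suc: "n \<ge> 1 \<Longrightarrow> growth (Suc n) = growth n * (1 + rate n)"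
  by (simp add: growth_def)

lemma growth_pos: "growth n > 0"
  unfolding growth_def by (intro prod_pos) (auto intro!: add_pos_pos rate_pos)

text \<open>For the identity function each step multiplies the expectation by 1 +
  \<open>rate k\<close>. This is the martingale property of the scaled count, tested against Y: an
  indicator gives its mean, and the count at time n gives the cross term in
  \<open>expectation_scaled_increment_sq\<close>.\<close>

lemma expectation_mult_Kn:
  assumes Y: "adapted n Y" "\<And>\<omega>. \<bar>Y \<omega>\<bar> \<le> C" "\<And>\<omega>. Kn S n c \<omega> = 0 \<Longrightarrow> Y \<omega> = 0"
    and n: "1 \<le> n" "n \<le> n'"
  shows "expectation (\<lambda>\<omega>. Y \<omega> * real (Kn S n' c \<omega>)) / growth n' =
    expectation (\<lambda>\<omega>. Y \<omega> * real (Kn S n c \<omega>)) / growth n"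
  using n(2)
proof (induction n' rule: dec_induct)
  case (step k)
  have Yk: "adapted k Y"
    using adapted_mono[OF Y(1) step.hyps(1)] .
  have Y0: "Y \<omega> = 0" if "Kn S k c \<omega> = 0" for \<omega>
    using Kn_mono[OF step.hyps(1), of c \<omega>] that by (intro Y(3)) simp
  have "expectation (\<lambda>\<omega>. Y \<omega> * real (Kn S (Suc k) c \<omega>)) =
      expectation (\<lambda>\<omega>. Y \<omega> * real (Kn S k c \<omega>)) + rate k * expectation
        (\<lambda>\<omega>. Y \<omega> * (real (Kn S k c \<omega>) * (real (Suc (Kn S k c \<omega>)) - real (Kn S k c \<omega>))))"
    by (rule expectation_next[OF Yk Y(2) Y0])
  hence "expectation (\<lambda>\<omega>. Y \<omega> * real (Kn S (Suc k) c \<omega>)) =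
      (1 + rate k) * expectation (\<lambda>\<omega>. Y \<omega> * real (Kn S k c \<omega>))"
    by (simp add: algebra_simps)
  moreover have "growth (Suc k) = (1 + rate k) * growth k" "1 + rate k > 0"
    using n step.hyps rate_pos[of k] by (auto simp: growth_Suc)
  ultimately show ?case
    using step.IH by simp
qed simp

text \<open>A fixed time m replaces the random time at which c first appears; countably many m cover
  all cases in the end.\<close>

definition alive :: "nat \<Rightarrow> nat \<Rightarrow> 'a \<Rightarrow> real" where
  "alive m c \<omega> = of_bool (Kn S m c \<omega> > 0)"

lemma adapted_alive: "m \<le> n \<Longrightarrow> adapted n (alive m c)"
  unfolding alive_def by (rule adapted_comp[OF adapted_Kn])

lemma measurable_alive [measurable]: "alive m c \<in> borel_measurable M"
  by (rule measurable_adapted[OF adapted_alive[OF order.refl]])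

lemma alive_bounded: "\<bar>alive m c \<omega>\<bar> \<le> 1" and alive_nonneg: "0 \<le> alive m c \<omega>"
  and alive_le_1: "alive m c \<omega> \<le> 1"
  by (auto simp: alive_def)

lemma alive_eq_0: "m \<le> n \<Longrightarrow> Kn S n c \<omega> = 0 \<Longrightarrow> alive m c \<omega> = 0"
  using Kn_mono[of m n c \<omega>] by (auto simp: alive_def)

lemma integrable_alive_mult:
  fixes f :: "nat \<Rightarrow> real"
  shows "integrable M (\<lambda>\<omega>. alive m c \<omega> * f (Kn S k c \<omega>))"
  by (rule integrable_mult_Kn[OF adapted_alive[OF order.refl] alive_bounded])

lemma expectation_alive_mult_next:
  fixes f :: "nat \<Rightarrow> real"
  assumes "m \<le> n"
  shows "expectation (\<lambda>\<omega>. alive m c \<omega> * f (Kn S (Suc n) c \<omega>)) =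
    expectation (\<lambda>\<omega>. alive m c \<omega> * f (Kn S n c \<omega>)) +
    rate n * expectation (\<lambda>\<omega>. alive m c \<omega> *
      (real (Kn S n c \<omega>) * (f (Suc (Kn S n c \<omega>)) - f (Kn S n c \<omega>))))"
  by (rule expectation_next[OF adapted_alive[OF assms] alive_bounded alive_eq_0[OF assms]])

section \<open>Second moments of the scaled count\<close>

definition scaled :: "nat \<Rightarrow> nat \<Rightarrow> nat \<Rightarrow> 'a \<Rightarrow> real" where
  "scaled m c n \<omega> = alive m c \<omega> * real (Kn S n c \<omega>) / growth n"

lemma measurable_scaled [measurable]: "scaled m c n \<in> borel_measurable M"
  unfolding scaled_def by measurable

text \<open>By \<open>expectation_alive_Kn\<close> this is the expectation of
  \<open>scaled m c n\<close> for every n \<ge> m, provided m \<ge> 1.\<close>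

definition mean :: "nat \<Rightarrow> nat \<Rightarrow> real" where
  "mean m c = expectation (scaled m c m)"

lemma mean_nonneg: "0 \<le> mean m c"
  unfolding mean_def scaled_def
  by (intro Bochner_Integration.integral_nonneg divide_nonneg_pos mult_nonneg_nonneg growth_pos alive_nonneg) simp

lemma expectation_alive_Kn:
  assumes "1 \<le> m" "m \<le> n"
  shows "expectation (\<lambda>\<omega>. alive m c \<omega> * real (Kn S n c \<omega>)) = mean m c * growth n"
proof -
  have "expectation (\<lambda>\<omega>. alive m c \<omega> * real (Kn S n c \<omega>)) / growth n = mean m c"
    using expectation_mult_Kn[OF adapted_alive[OF order.refl] alive_bounded
        alive_eq_0[OF order.refl] assms, of c c]
    by (simp add: mean_def scaled_def[abs_def])
  thus ?thesis
    using growth_pos[of n] by (simp add: field_simps)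
qed

text \<open>With A = a_k and x = x_k, one step turns the second moment V into (1 + 2x) V + x \<mu>
  A. As 1 + 2x \<le> (1 + x)^2, the quotient V / A^2 grows by at most x \<mu> / (A (1 + x)^2), which
  is covered by the drop x \<mu> / (A (1 + x)) of the correction \<mu> / A.\<close>

lemma second_moment_antimono:
  assumes "1 \<le> m" "m \<le> n" "n \<le> n'"
  shows "expectation (\<lambda>\<omega>. alive m c \<omega> * (real (Kn S n' c \<omega>))\<^sup>2) / (growth n')\<^sup>2 + mean m c / growth n' \<le>
    expectation (\<lambda>\<omega>. alive m c \<omega> * (real (Kn S n c \<omega>))\<^sup>2) / (growth n)\<^sup>2 + mean m c / growth n"
  using assms(3)
proof (induction n' rule: dec_induct)
  case (step k)
  define A where "A = growth k"
  define x where "x = rate k"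
  define \<mu> where "\<mu> = mean m c"
  define V where "V = expectation (\<lambda>\<omega>. alive m c \<omega> * (real (Kn S k c \<omega>))\<^sup>2)"
  have pos: "A > 0" "x > 0" "\<mu> \<ge> 0"
    using growth_pos[of k] rate_pos[of k] assms step.hyps mean_nonneg by (auto simp: A_def x_def \<mu>_def)
  have V0: "V \<ge> 0"
    unfolding V_def by (intro Bochner_Integration.integral_nonneg mult_nonneg_nonneg alive_nonneg) simp
  have "expectation (\<lambda>\<omega>. alive m c \<omega> * (real (Kn S (Suc k) c \<omega>))\<^sup>2) =
      V + x * expectation (\<lambda>\<omega>. alive m c \<omega> * (2 * (real (Kn S k c \<omega>))\<^sup>2 + real (Kn S k c \<omega>)))"
    unfolding V_def x_def
    using assms step.hyps expectation_alive_mult_next[of m k c "\<lambda>n. (real n)\<^sup>2"]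
    by (simp add: power2_eq_square algebra_simps)
  also have "expectation (\<lambda>\<omega>. alive m c \<omega> * (2 * (real (Kn S k c \<omega>))\<^sup>2 + real (Kn S k c \<omega>))) =
      expectation (\<lambda>\<omega>. 2 * (alive m c \<omega> * (real (Kn S k c \<omega>))\<^sup>2) + alive m c \<omega> * real (Kn S k c \<omega>))"
    by (intro Bochner_Integration.integral_cong) (auto simp: algebra_simps)
  also have "\<dots> = 2 * V + \<mu> * A"
    unfolding V_def \<mu>_def A_def using assms step.hyps
    by (subst Bochner_Integration.integral_add)
       (auto simp: expectation_alive_Kn integrable_alive_mult intro!: integrable_alive_mult[of m c "\<lambda>n. (real n)\<^sup>2"])
  finally have E: "expectation (\<lambda>\<omega>. alive m c \<omega> * (real (Kn S (Suc k) c \<omega>))\<^sup>2) =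
      V + x * (2 * V + \<mu> * A)" .
  have "(V + x * (2 * V + \<mu> * A)) / (A * (1 + x))\<^sup>2 + \<mu> / (A * (1 + x)) \<le> V / A\<^sup>2 + \<mu> / A"
  proof -
    have "V / A\<^sup>2 + \<mu> / A - ((V + x * (2 * V + \<mu> * A)) / (A * (1 + x))\<^sup>2 + \<mu> / (A * (1 + x))) =
        (V * x\<^sup>2 + \<mu> * A * x\<^sup>2) / (A * (1 + x))\<^sup>2"
      using pos by (simp add: divide_simps) (simp add: power2_eq_square algebra_simps)
    also have "\<dots> \<ge> 0"
      using pos V0 by (intro divide_nonneg_nonneg add_nonneg_nonneg mult_nonneg_nonneg) auto
    finally show ?thesis by simp
  qed
  moreover have "growth (Suc k) = A * (1 + x)"
    using assms step.hyps by (simp add: A_def x_def growth_Suc)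
  ultimately show ?case
    using step.IH E by (simp add: A_def V_def \<mu>_def)
qed simp

text \<open>By the martingale property the cross term equals the second moment at time n, so the
  left side is a difference of two second moments, which \<open>second_moment_antimono\<close>
  controls.\<close>

lemma expectation_scaled_increment_sq:
  assumes "1 \<le> m" "m \<le> n" "n \<le> n'"
  shows "expectation (\<lambda>\<omega>. (scaled m c n' \<omega> - scaled m c n \<omega>)\<^sup>2) \<le> mean m c / growth n"
proof -
  let ?v = "\<lambda>n. expectation (\<lambda>\<omega>. alive m c \<omega> * (real (Kn S n c \<omega>))\<^sup>2)"
  define Y where "Y \<omega> = alive m c \<omega> * real (Kn S n c \<omega>)" for \<omega>
  have Y: "adapted n Y"
    unfolding Y_def by (rule adapted_comp2[OF adapted_alive[OF assms(2)] adapted_Kn[OF order.refl]])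
  have Yb: "\<bar>Y \<omega>\<bar> \<le> real n" for \<omega>
  proof -
    have "\<bar>Y \<omega>\<bar> \<le> 1 * real (Kn S n c \<omega>)"
      unfolding Y_def abs_mult by (intro mult_mono alive_bounded) auto
    also have "\<dots> \<le> real n"
      using Kcount_le by (simp add: Kn_def)
    finally show ?thesis .
  qed
  have Y0: "Y \<omega> = 0" if "Kn S n c \<omega> = 0" for \<omega>
    using that by (simp add: Y_def)
  have n: "1 \<le> n" using assms by simp
  have "expectation (\<lambda>\<omega>. Y \<omega> * real (Kn S n' c \<omega>)) / growth n' =
      expectation (\<lambda>\<omega>. Y \<omega> * real (Kn S n c \<omega>)) / growth n"
    by (rule expectation_mult_Kn[OF Y Yb Y0 n assms(3)])
  also have "(\<lambda>\<omega>. Y \<omega> * real (Kn S n c \<omega>)) = (\<lambda>\<omega>. alive m c \<omega> * (real (Kn S n c \<omega>))\<^sup>2)"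
    by (simp add: Y_def power2_eq_square mult_ac)
  finally have cross: "expectation (\<lambda>\<omega>. Y \<omega> * real (Kn S n' c \<omega>)) / growth n' = ?v n / growth n" .
  have i1: "integrable M (\<lambda>\<omega>. alive m c \<omega> * (real (Kn S k c \<omega>))\<^sup>2)" for k
    by (rule integrable_alive_mult[of m c "\<lambda>n. (real n)\<^sup>2"])
  have i2: "integrable M (\<lambda>\<omega>. Y \<omega> * real (Kn S n' c \<omega>))"
    by (rule integrable_mult_Kn[OF Y Yb])
  \<comment> \<open>\<open>alive\<close> takes the values 0 and 1, so its square is itself.\<close>
  have "(scaled m c n' \<omega> - scaled m c n \<omega>)\<^sup>2 =
      alive m c \<omega> * (real (Kn S n' c \<omega>))\<^sup>2 / (growth n')\<^sup>2 -
      2 / (growth n * growth n') * (Y \<omega> * real (Kn S n' c \<omega>)) +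
      alive m c \<omega> * (real (Kn S n c \<omega>))\<^sup>2 / (growth n)\<^sup>2" for \<omega>
    unfolding Y_def scaled_def by (cases "Kn S m c \<omega> > 0")
       (auto simp: alive_def power2_diff power_divide power_mult_distrib mult_ac)
  hence "expectation (\<lambda>\<omega>. (scaled m c n' \<omega> - scaled m c n \<omega>)\<^sup>2) =
      ?v n' / (growth n')\<^sup>2 -
      2 / (growth n * growth n') * expectation (\<lambda>\<omega>. Y \<omega> * real (Kn S n' c \<omega>)) +
      ?v n / (growth n)\<^sup>2"
    by (simp only: Bochner_Integration.integral_add Bochner_Integration.integral_diff
        integrable_divide_zero integrable_mult_right integrable_diff
        integral_divide_zero integral_mult_right_zero Bochner_Integration.integrable_diff i1 i2)
  also have "\<dots> = ?v n' / (growth n')\<^sup>2 - ?v n / (growth n)\<^sup>2"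
  proof -
    have "2 / (growth n * growth n') * expectation (\<lambda>\<omega>. Y \<omega> * real (Kn S n' c \<omega>)) =
        2 / growth n * (expectation (\<lambda>\<omega>. Y \<omega> * real (Kn S n' c \<omega>)) / growth n')"
      by simp
    also have "\<dots> = 2 * (?v n / (growth n)\<^sup>2)"
      unfolding cross by (simp add: power2_eq_square)
    finally show ?thesis by simp
  qed
  also have "\<dots> \<le> mean m c / growth n - mean m c / growth n'"
    using second_moment_antimono[OF assms, of c] by linarith
  also have "\<dots> \<le> mean m c / growth n"
    using mean_nonneg[of m c] growth_pos[of n'] by simp
  finally show ?thesis .
qed

section \<open>Almost sure convergence along a subsequence\<close>

lemma integrable_scaled: "integrable M (scaled m c n)"
  unfolding scaled_def by (intro integrable_divide_zero integrable_alive_mult)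

text \<open>The square of the mean is at most the mean of the square, because the variance is
  nonnegative.\<close>

lemma expectation_scaled_increment:
  assumes "1 \<le> m" "m \<le> n" "n \<le> n'"
  shows "expectation (\<lambda>\<omega>. \<bar>scaled m c n' \<omega> - scaled m c n \<omega>\<bar>) \<le> sqrt (mean m c) * (1 / sqrt (growth n))"
proof -
  let ?X = "\<lambda>\<omega>. \<bar>scaled m c n' \<omega> - scaled m c n \<omega>\<bar>"
  have b: "\<bar>scaled m c k \<omega>\<bar> \<le> real k / growth k" for k \<omega>
  proof -
    have "\<bar>scaled m c k \<omega>\<bar> = \<bar>alive m c \<omega>\<bar> * real (Kn S k c \<omega>) / growth k"
      using growth_pos[of k] by (simp add: scaled_def abs_mult)
    also have "\<dots> \<le> 1 * real k / growth k"
      using growth_pos[of k] Kcount_le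
      by (intro divide_right_mono mult_mono alive_bounded) (auto simp: Kn_def)
    finally show ?thesis by simp
  qed
  have int: "integrable M ?X"
    by (intro integrable_abs Bochner_Integration.integrable_diff integrable_scaled)
  have int2: "integrable M (\<lambda>\<omega>. (?X \<omega>)\<^sup>2)"
  proof (rule integrable_const_bound[where B = "(real n' / growth n' + real n / growth n)\<^sup>2"])
    show "AE \<omega> in M. norm ((?X \<omega>)\<^sup>2) \<le> (real n' / growth n' + real n / growth n)\<^sup>2"
    proof (rule AE_I2)
      fix \<omega>
      have "?X \<omega> \<le> real n' / growth n' + real n / growth n"
        using b[of n' \<omega>] b[of n \<omega>] by linarith
      thus "norm ((?X \<omega>)\<^sup>2) \<le> (real n' / growth n' + real n / growth n)\<^sup>2"
        unfolding real_norm_def abs_power2 by (rule power_mono) simp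
    qed
  qed measurable
  have "0 \<le> expectation (\<lambda>\<omega>. (?X \<omega>)\<^sup>2) - (expectation ?X)\<^sup>2"
    using variance_positive[of ?X] variance_eq[OF int int2] by simp
  hence "(expectation ?X)\<^sup>2 \<le> mean m c / growth n"
    using expectation_scaled_increment_sq[OF assms, of c] by simp
  hence "expectation ?X \<le> sqrt (mean m c / growth n)"
    by (rule real_le_rsqrt)
  thus ?thesis
    by (simp add: real_sqrt_divide)
qed

text \<open>The expected sum of absolute increments along N is finite, so almost surely the
  increments are absolutely summable and telescope to a convergent sequence.\<close>

lemma AE_scaled_convergent_subseq:
  assumes "1 \<le> m" "strict_mono N" "m \<le> N 0" and sum: "summable (\<lambda>k. 1 / sqrt (growth (N k)))"
  shows "AE \<omega> in M. convergent (\<lambda>k. scaled m c (N k) \<omega>)"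
proof -
  let ?X = "\<lambda>k \<omega>. \<bar>scaled m c (N (Suc k)) \<omega> - scaled m c (N k) \<omega>\<bar>"
  let ?b = "\<lambda>k. sqrt (mean m c) * (1 / sqrt (growth (N k)))"
  have mN: "m \<le> N k" for k
    using assms(3) monoD[OF strict_mono_mono[OF assms(2)], of 0 k] by simp
  have NN: "N k \<le> N (Suc k)" for k
    using monoD[OF strict_mono_mono[OF assms(2)], of k "Suc k"] by simp
  have "(\<integral>\<^sup>+\<omega>. (\<Sum>k. ennreal (?X k \<omega>)) \<partial>M) = (\<Sum>k. \<integral>\<^sup>+\<omega>. ennreal (?X k \<omega>) \<partial>M)"
    by (rule nn_integral_suminf) measurable
  also have "\<dots> = (\<Sum>k. ennreal (expectation (?X k)))"
    by (intro suminf_cong nn_integral_eq_integral integrable_abs Bochner_Integration.integrable_diff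
        integrable_scaled) auto
  also have "\<dots> \<le> (\<Sum>k. ennreal (?b k))"
    by (intro suminf_le summableI ennreal_leI expectation_scaled_increment assms mN NN)
  also have "\<dots> = ennreal (\<Sum>k. ?b k)"
    by (intro suminf_ennreal2 summable_mult sum mult_nonneg_nonneg)
       (simp_all add: mean_nonneg growth_pos less_imp_le)
  also have "\<dots> < \<infinity>"
    by simp
  finally have "(\<integral>\<^sup>+\<omega>. (\<Sum>k. ennreal (?X k \<omega>)) \<partial>M) \<noteq> \<infinity>"
    by simp
  hence "AE \<omega> in M. (\<Sum>k. ennreal (?X k \<omega>)) \<noteq> \<infinity>"
    by (intro nn_integral_noteq_infinite) measurable
  thus ?thesis
  proof eventually_elim
    case (elim \<omega>)
    hence "summable (\<lambda>k. ?X k \<omega>)"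
      by (intro summable_suminf_not_top) auto
    hence "summable (\<lambda>k. scaled m c (N (Suc k)) \<omega> - scaled m c (N k) \<omega>)"
      by (rule summable_rabs_cancel)
    hence "convergent (\<lambda>n. \<Sum>k<n. scaled m c (N (Suc k)) \<omega> - scaled m c (N k) \<omega>)"
      by (simp add: summable_iff_convergent)
    hence "convergent (\<lambda>n. scaled m c (N n) \<omega> - scaled m c (N 0) \<omega>)"
      by (simp only: sum_lessThan_telescope[where f = "\<lambda>n. scaled m c (N n) \<omega>"])
    thus ?case
      by (simp only: convergent_diff_const_right_iff)
  qed
qed

section \<open>Positivity of the limit\<close>

definition decay :: "nat \<Rightarrow> real" where
  "decay n = (\<Prod>j=1..<n. 1 - rate j / 2)"

lemma decay_pos: "decay n > 0"
  unfolding decay_def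
proof (intro prod_pos)
  fix j assume "j \<in> {1..<n}"
  thus "0 < 1 - rate j / 2" using rate_le_1[of j] by simp
qed

lemma sqrt_growth_le: "sqrt (growth n) \<le> 1 / decay n"
proof -
  have "(decay n)\<^sup>2 * growth n = (\<Prod>j=1..<n. (1 - rate j / 2)\<^sup>2 * (1 + rate j))"
    by (simp add: decay_def growth_def prod.distrib prod_power_distrib)
  also have "\<dots> \<le> 1"
    using rate_le_1 rate_pos
    by (intro prod_le_1 conjI sq_one_minus_half_mult_le_1 mult_nonneg_nonneg)
       (auto simp: less_imp_le add_nonneg_nonneg)
  finally have "growth n \<le> (1 / decay n)\<^sup>2"
    using decay_pos[of n] by (simp add: field_simps)
  thus ?thesis
    using decay_pos[of n] by (intro real_le_lsqrt) auto
qed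

text \<open>The eigenvalue - 1/2 makes each step multiply the expectation by 1 -
  \<open>rate k\<close> / 2, so the quotient is constant in n. At n = m it is bounded because
  \<open>half_weight\<close> is at most 1.\<close>

lemma expectation_half_weight:
  assumes "1 \<le> m" "m \<le> n"
  shows "expectation (\<lambda>\<omega>. alive m c \<omega> * half_weight (Kn S n c \<omega>)) / decay n \<le> 1 / decay m"
  using assms(2)
proof (induction n rule: dec_induct)
  case base
  have "expectation (\<lambda>\<omega>. alive m c \<omega> * half_weight (Kn S m c \<omega>)) \<le> 1"
    by (intro integral_le_const integrable_alive_mult AE_I2 mult_le_one alive_le_1
        half_weight_le_1 half_weight_nonneg)
  thus ?case
    using decay_pos[of m] by (simp add: divide_right_mono)
next
  case (step k)
  let ?e = "expectation (\<lambda>\<omega>. alive m c \<omega> * half_weight (Kn S k c \<omega>))"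
  have "alive m c \<omega> * (real (Kn S k c \<omega>) * (half_weight (Suc (Kn S k c \<omega>)) - half_weight (Kn S k c \<omega>))) =
      - 1 / 2 * (alive m c \<omega> * half_weight (Kn S k c \<omega>))" for \<omega>
    using alive_eq_0[OF step.hyps(1), of c \<omega>] by (cases "Kn S k c \<omega> = 0") (auto simp: half_weight_Suc)
  hence "expectation (\<lambda>\<omega>. alive m c \<omega> * half_weight (Kn S (Suc k) c \<omega>)) = ?e + rate k * (- 1 / 2 * ?e)"
    unfolding expectation_alive_mult_next[OF step.hyps(1)] by (simp only: integral_mult_right_zero)
  also have "\<dots> = (1 - rate k / 2) * ?e"
    by (simp add: algebra_simps)
  also have "\<dots> / decay (Suc k) = ?e / decay k"
    using assms step.hyps rate_le_1[of k] by (simp add: decay_def)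
  finally show ?case using step.IH by simp
qed

text \<open>Combines \<open>sqrt_growth_le\<close> with \<open>half_weight_ge\<close>. The bound
  does not depend on n, as Fatou's lemma requires.\<close>

lemma expectation_inverse_sqrt:
  assumes "1 \<le> m" "m \<le> n"
  shows "(\<integral>\<^sup>+\<omega>. ennreal (alive m c \<omega> * sqrt (growth n / real (Kn S n c \<omega>))) \<partial>M) \<le> ennreal (2 / decay m)"
proof -
  have le: "alive m c \<omega> * sqrt (growth n / real (Kn S n c \<omega>)) \<le>
      2 / decay n * (alive m c \<omega> * half_weight (Kn S n c \<omega>))" for \<omega>
  proof (cases "alive m c \<omega> = 0")
    case False
    hence K: "Kn S n c \<omega> \<ge> 1"
      using alive_eq_0[OF assms(2), of c \<omega>] by (cases "Kn S n c \<omega>") auto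
    have "sqrt (growth n / real (Kn S n c \<omega>)) = 2 * (sqrt (growth n) * (1 / (2 * sqrt (real (Kn S n c \<omega>)))))"
      by (simp add: real_sqrt_divide)
    also have "\<dots> \<le> 2 * (1 / decay n * half_weight (Kn S n c \<omega>))"
      using decay_pos[of n] by (intro mult_left_mono mult_mono sqrt_growth_le half_weight_ge K) auto
    finally have "sqrt (growth n / real (Kn S n c \<omega>)) \<le> 2 * (1 / decay n * half_weight (Kn S n c \<omega>))" .
    from mult_left_mono[OF this alive_nonneg[of m c \<omega>]] show ?thesis
      by (simp add: mult_ac)
  qed simp
  have "(\<integral>\<^sup>+\<omega>. ennreal (alive m c \<omega> * sqrt (growth n / real (Kn S n c \<omega>))) \<partial>M) \<le>
      (\<integral>\<^sup>+\<omega>. ennreal (2 / decay n * (alive m c \<omega> * half_weight (Kn S n c \<omega>))) \<partial>M)"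
    by (intro nn_integral_mono ennreal_leI le)
  also have "\<dots> = ennreal (expectation (\<lambda>\<omega>. 2 / decay n * (alive m c \<omega> * half_weight (Kn S n c \<omega>))))"
    using decay_pos[of n]
    by (intro nn_integral_eq_integral integrable_mult_right integrable_alive_mult AE_I2
        mult_nonneg_nonneg alive_nonneg half_weight_nonneg) auto
  also have "expectation (\<lambda>\<omega>. 2 / decay n * (alive m c \<omega> * half_weight (Kn S n c \<omega>))) =
      2 * (expectation (\<lambda>\<omega>. alive m c \<omega> * half_weight (Kn S n c \<omega>)) / decay n)"
    by simp
  also have "\<dots> \<le> 2 * (1 / decay m)"
    by (intro mult_left_mono expectation_half_weight assms) auto
  finally show ?thesis
    by (simp add: ennreal_leI)
qed

text \<open>By Fatou's lemma the lower limit of sqrt (a_n / K_n) is almost surely finite once c is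
  present, whereas K_n / a_n tending to 0 would make it infinite.\<close>

lemma AE_not_tendsto_0:
  assumes "1 \<le> m"
  shows "AE \<omega> in M. Kn S m c \<omega> > 0 \<longrightarrow> \<not> (\<lambda>n. real (Kn S n c \<omega>) / growth n) \<longlonglongrightarrow> 0"
proof -
  \<comment> \<open>The shift by m puts every index in the range n \<ge> m of the uniform
    bound.\<close>
  let ?f = "\<lambda>n \<omega>. alive m c \<omega> * sqrt (growth (n + m) / real (Kn S (n + m) c \<omega>))"
  have "(\<integral>\<^sup>+\<omega>. liminf (\<lambda>n. ennreal (?f n \<omega>)) \<partial>M) \<le> liminf (\<lambda>n. \<integral>\<^sup>+\<omega>. ennreal (?f n \<omega>) \<partial>M)"
    by (rule nn_integral_liminf) measurable
  also have "\<dots> \<le> liminf (\<lambda>n. ennreal (2 / decay m))"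
    using expectation_inverse_sqrt[OF assms] by (intro Liminf_mono always_eventually allI) simp
  also have "\<dots> < \<infinity>"
    by (simp add: Liminf_const)
  finally have fin: "(\<integral>\<^sup>+\<omega>. liminf (\<lambda>n. ennreal (?f n \<omega>)) \<partial>M) < \<infinity>" .
  have "AE \<omega> in M. liminf (\<lambda>n. ennreal (?f n \<omega>)) \<noteq> \<infinity>"
  proof (rule nn_integral_noteq_infinite)
    show "(\<lambda>\<omega>. liminf (\<lambda>n. ennreal (?f n \<omega>))) \<in> borel_measurable M" by measurable
  qed (use fin in simp)
  thus ?thesis
  proof eventually_elim
    case (elim \<omega>)
    show ?case
    proof (intro impI notI)
      assume K: "Kn S m c \<omega> > 0" and lim: "(\<lambda>n. real (Kn S n c \<omega>) / growth n) \<longlonglongrightarrow> 0"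
      let ?g = "\<lambda>n. real (Kn S (n + m) c \<omega>) / growth (n + m)"
      have "?g \<longlonglongrightarrow> 0"
        by (rule LIMSEQ_ignore_initial_segment[OF lim])
      moreover have pos: "?g n > 0" for n
        using K Kn_mono[of m "n + m" c \<omega>] growth_pos by simp
      ultimately have "filterlim ?g (at_right 0) sequentially"
        by (intro filterlim_at_withinI always_eventually allI) simp_all
      hence "filterlim (\<lambda>n. inverse (?g n)) at_top sequentially"
        by (rule filterlim_compose[OF filterlim_inverse_at_top_right])
      hence "filterlim (\<lambda>n. sqrt (inverse (?g n))) at_top sequentially"
        by (rule filterlim_compose[OF sqrt_at_top])
      also have "(\<lambda>n. sqrt (inverse (?g n))) = (\<lambda>n. ?f n \<omega>)"
        using K by (simp add: alive_def)
      finally have "(\<lambda>n. ennreal (?f n \<omega>)) \<longlonglongrightarrow> \<infinity>"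
        by (simp add: ennreal_tendsto_top_eq_at_top)
      hence "liminf (\<lambda>n. ennreal (?f n \<omega>)) = \<infinity>"
        by (intro lim_imp_Liminf) auto
      thus False using elim by simp
    qed
  qed
qed

section \<open>Power-law asymptotics of a single colour\<close>

lemma AE_Kn_asymp:
  assumes \<alpha>: "\<alpha> > 0" and L: "L > 0" and lim: "(\<lambda>n. growth n / real n powr \<alpha>) \<longlonglongrightarrow> L"
    and m: "1 \<le> m"
  shows "AE \<omega> in M. Kn S m c \<omega> > 0 \<longrightarrow>
    (\<exists>y>0. (\<lambda>n. real (Kn S n c \<omega>) / real n powr \<alpha>) \<longlonglongrightarrow> y)"
proof -
  \<comment> \<open>With \<gamma> \<alpha> \<ge> 4, a_n along n = (k + m)^\<gamma> is at least of
    order k^4, so 1 / sqrt a_n is O(k^(-2)) and summable. A polynomial subsequence still has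
    neighbouring ratios tending to 1; a geometric one would not.\<close>
  define \<gamma> where "\<gamma> = nat \<lceil>4 / \<alpha>\<rceil>"
  have \<gamma>: "real \<gamma> * \<alpha> \<ge> 4" and \<gamma>_pos: "\<gamma> > 0"
  proof -
    have "real \<gamma> \<ge> 4 / \<alpha>" unfolding \<gamma>_def by linarith
    thus "real \<gamma> * \<alpha> \<ge> 4" using \<alpha> by (simp add: field_simps)
    thus "\<gamma> > 0" by (cases "\<gamma> = 0") auto
  qed
  define N where "N k = (k + m) ^ \<gamma>" for k
  define u where "u n = real n powr \<alpha>" for n
  have N: "strict_mono N"
    unfolding N_def strict_mono_def using \<gamma>_pos by (auto intro!: power_strict_mono)
  have N0: "m \<le> N 0"
    using self_le_power[of m \<gamma>] m \<gamma>_pos by (simp add: N_def)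
  have uN: "u (N k) = real (k + m) powr (real \<gamma> * \<alpha>)" for k
    using m by (simp add: u_def N_def powr_powr flip: powr_realpow)
  have lim_N: "(\<lambda>k. growth (N k) / u (N k)) \<longlonglongrightarrow> L"
    unfolding u_def using LIMSEQ_subseq_LIMSEQ[OF lim N] by (simp add: o_def)
  have u_pos: "u (N k) > 0" for k
    using m by (simp add: uN)
  have "summable (\<lambda>k. 1 / sqrt (growth (N k)))"
  proof (rule summable_comparison_test_ev)
    show "summable (\<lambda>k. sqrt (2 / L) * real k powr (-2))"
      by (intro summable_mult) (simp add: summable_real_powr_iff)
    have "\<forall>\<^sub>F k in sequentially. growth (N k) / u (N k) > L / 2"
      using order_tendstoD(1)[OF lim_N, of "L / 2"] L by simp
    thus "\<forall>\<^sub>F k in sequentially. norm (1 / sqrt (growth (N k))) \<le> sqrt (2 / L) * real k powr (-2)"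
      using eventually_gt_at_top[of 0]
    proof eventually_elim
      case (elim k)
      have "real k ^ 4 \<le> real (k + m) powr 4"
        by (simp add: powr_numeral power_mono)
      also have "\<dots> \<le> u (N k)"
        unfolding uN using \<gamma> elim by (intro powr_mono) auto
      finally have "L / 2 * real k ^ 4 \<le> L / 2 * u (N k)"
        using L by (intro mult_left_mono) auto
      also have "\<dots> \<le> growth (N k)"
        using elim(1) u_pos[of k] by (simp add: field_simps)
      finally have "1 / sqrt (growth (N k)) \<le> 1 / sqrt (L / 2 * real k ^ 4)"
        using L elim by (intro divide_left_mono real_sqrt_le_mono mult_pos_pos real_sqrt_gt_zero growth_pos) auto
      also have "sqrt (L / 2 * real k ^ 4) = sqrt (L / 2) * (real k)\<^sup>2"
      proof -
        have "real k ^ 4 = ((real k)\<^sup>2)\<^sup>2" by simp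
        thus ?thesis by (simp only: real_sqrt_mult real_sqrt_abs abs_power2)
      qed
      also have "1 / (sqrt (L / 2) * (real k)\<^sup>2) = sqrt (2 / L) * real k powr (-2)"
        using L elim by (simp add: real_sqrt_divide powr_minus powr_numeral field_simps)
      finally show ?case
        using growth_pos[of "N k"] by simp
    qed
  qed
  from AE_scaled_convergent_subseq[OF m N N0 this, of c] AE_not_tendsto_0[OF m, of c]
  show ?thesis
  proof eventually_elim
    case (elim \<omega>)
    let ?K = "\<lambda>n. real (Kn S n c \<omega>)"
    show ?case
    proof
      assume K: "Kn S m c \<omega> > 0"
      hence scaled_eq: "scaled m c k \<omega> = ?K k / growth k" for k
        by (simp add: scaled_def alive_def)
      obtain x where x: "(\<lambda>k. ?K (N k) / growth (N k)) \<longlonglongrightarrow> x"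
        using elim(1) unfolding scaled_eq convergent_def by blast
      have x0: "x \<ge> 0"
        using growth_pos by (intro LIMSEQ_le_const[OF x]) (auto simp: less_imp_le)
      have lim_K: "(\<lambda>n. ?K n / u n) \<longlonglongrightarrow> x * L"
      proof (rule mono_ratio_tendsto_of_subseq)
        show "mono ?K" by (intro monoI) (simp add: Kn_mono)
        show "mono u" using \<alpha> by (intro monoI) (simp add: u_def powr_mono2)
        show "0 < u n" if "n \<ge> 1" for n using that by (simp add: u_def)
        show "strict_mono N" "N 0 \<ge> 1" using N N0 m by auto
        show "(\<lambda>k. ?K (N k) / u (N k)) \<longlonglongrightarrow> x * L"
        proof -
          have "(\<lambda>k. ?K (N k) / growth (N k) * (growth (N k) / u (N k))) \<longlonglongrightarrow> x * L"
            by (intro tendsto_mult x lim_N)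
          moreover have "?K (N k) / growth (N k) * (growth (N k) / u (N k)) = ?K (N k) / u (N k)" for k
            using growth_pos[of "N k"] by simp
          ultimately show ?thesis by (simp only:)
        qed
        show "(\<lambda>k. u (N (Suc k)) / u (N k)) \<longlonglongrightarrow> 1"
        proof -
          have "(\<lambda>k. real (Suc (k + m)) / real (k + m)) \<longlonglongrightarrow> 1"
            by (rule LIMSEQ_ignore_initial_segment[OF LIMSEQ_Suc_n_over_n])
          hence "(\<lambda>k. (real (Suc (k + m)) / real (k + m)) powr (real \<gamma> * \<alpha>)) \<longlonglongrightarrow> 1 powr (real \<gamma> * \<alpha>)"
            by (intro tendsto_intros) auto
          thus ?thesis
            by (simp add: uN powr_divide)
        qed
      qed simp
      \<comment> \<open>If x = 0, replacing the power of n by \<open>growth n\<close> again gives a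
        limit 0 along all n, contradicting \<open>AE_not_tendsto_0\<close>.\<close>
      have "x \<noteq> 0"
      proof
        assume "x = 0"
        have "(\<lambda>n. (?K n / u n) / (growth n / real n powr \<alpha>)) \<longlonglongrightarrow> (x * L) / L"
          using L by (intro tendsto_divide lim_K lim) auto
        moreover have "\<forall>\<^sub>F n in sequentially. (?K n / u n) / (growth n / real n powr \<alpha>) = ?K n / growth n"
          using eventually_gt_at_top[of 0] by eventually_elim (simp add: u_def)
        ultimately have "(\<lambda>n. ?K n / growth n) \<longlonglongrightarrow> (x * L) / L"
          by (rule Lim_transform_eventually)
        thus False
          using elim(2) K \<open>x = 0\<close> by simp
      qed
      hence "x * L > 0" using x0 L by simp
      thus "\<exists>y>0. (\<lambda>n. ?K n / real n powr \<alpha>) \<longlonglongrightarrow> y"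
        using lim_K unfolding u_def by blast
    qed
  qed
qed

end

section \<open>Observed colours and the limit variable\<close>

theorem theorem3p3:
  fixes M :: "'a measure" and \<rho> p \<beta> :: real and pn :: "nat \<Rightarrow> real"
    and B :: "nat \<Rightarrow> 'a \<Rightarrow> bool" and S :: "nat \<Rightarrow> 'a \<Rightarrow> nat" and c :: nat
  assumes "\<rho> > 0"
    and "\<forall>n\<ge>1. 0 < pn n \<and> pn n < 1"
    and "0 \<le> p" and "p < 1" and "\<beta> > p"
    and "(\<lambda>n. pn n - p) \<in> O(\<lambda>n. real n powr (- \<beta>))"
    and "triggered_urn M (\<lambda>x. \<rho> * x) pn B S"
  shows "\<exists>Kc :: 'a \<Rightarrow> real. Kc \<in> borel_measurable M \<and>
           (AE \<omega> in M. (1 \<le> c \<and> (\<exists>n. c \<le> Cn B n \<omega>)) \<longrightarrow>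
              0 < Kc \<omega> \<and> (\<lambda>n. real (Kn S n c \<omega>) / real n powr (1 - p)) \<longlonglongrightarrow> Kc \<omega>)"
proof -
  interpret linear_urn M \<rho> pn B S
  proof (rule linear_urn.intro)
    show "0 < pn n" "pn n < 1" if "n \<ge> 1" for n
      using assms(2) that by simp_all
  qed (rule assms)+
  have "(\<lambda>n. (1 - pn n) - (1 - p)) \<in> O(\<lambda>n. real n powr (- \<beta>))"
    using landau_o.big.uminus_in_iff[THEN iffD2, OF assms(6)] by simp
  \<comment> \<open>The product lemma is applied with q n = 1 - p_n and \<alpha> = 1 - p; \<beta> >
    0 follows from 0 \<le> p < \<beta>.\<close>
  then obtain L where L: "L > 0" "(\<lambda>n. (\<Prod>j=1..<n. 1 + (1 - pn j) / real j) / real n powr (1 - p)) \<longlonglongrightarrow> L"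
    using assms by (elim prod_growth_asymp[rotated 3]) (auto simp: less_imp_le)
  have lim: "(\<lambda>n. growth n / real n powr (1 - p)) \<longlonglongrightarrow> L"
    using L(2) by (simp add: growth_def rate_def)
  \<comment> \<open>\<open>lim\<close> gives a total function that is measurable and agrees with the
    limit wherever the latter exists.\<close>
  define Kc where "Kc \<omega> = lim (\<lambda>n. real (Kn S n c \<omega>) / real n powr (1 - p))" for \<omega>
  have "AE \<omega> in M. \<forall>m. 1 \<le> m \<and> Kn S m c \<omega> > 0 \<longrightarrow>
      (\<exists>y>0. (\<lambda>n. real (Kn S n c \<omega>) / real n powr (1 - p)) \<longlonglongrightarrow> y)"
  proof (subst AE_all_countable, intro allI)
    fix m
    show "AE \<omega> in M. 1 \<le> m \<and> Kn S m c \<omega> > 0 \<longrightarrow>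
      (\<exists>y>0. (\<lambda>n. real (Kn S n c \<omega>) / real n powr (1 - p)) \<longlonglongrightarrow> y)"
      using AE_Kn_asymp[OF _ L(1) lim, of m c] assms(4) by (cases "1 \<le> m") auto
  qed
  with AE_colours have "AE \<omega> in M. (1 \<le> c \<and> (\<exists>n. c \<le> Cn B n \<omega>)) \<longrightarrow>
      0 < Kc \<omega> \<and> (\<lambda>n. real (Kn S n c \<omega>) / real n powr (1 - p)) \<longlonglongrightarrow> Kc \<omega>"
  proof eventually_elim
    case (elim \<omega>)
    show ?case
    proof
      assume "1 \<le> c \<and> (\<exists>n. c \<le> Cn B n \<omega>)"
      then obtain n where "c \<in> {1..Cn B n \<omega>}" by auto
      \<comment> \<open>A label not exceeding \<open>Cn B n \<omega>\<close> has been registered by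
        time n, so n itself serves as the starting time m.\<close>
      hence "c \<in> (\<lambda>k. S k \<omega>) ` {1..n}" using elim(1) by blast
      hence "1 \<le> n" "Kn S n c \<omega> > 0"
        unfolding Kn_def Kcount_pos_iff by auto
      then obtain y where y: "y > 0" "(\<lambda>n. real (Kn S n c \<omega>) / real n powr (1 - p)) \<longlonglongrightarrow> y"
        using elim(2) by blast
      thus "0 < Kc \<omega> \<and> (\<lambda>n. real (Kn S n c \<omega>) / real n powr (1 - p)) \<longlonglongrightarrow> Kc \<omega>"
        unfolding Kc_def limI[OF y(2)] by simp
    qed
  qed
  moreover have "Kc \<in> borel_measurable M"
    unfolding Kc_def by measurable
  ultimately show ?thesis by blast
qed

end
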